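(* Let $K$ be a field of characteristic $0$. Let $\mathcal{P}_2$ be the variety of binary perm algebras over $K$, i.e. the variety of $K$-algebras all of whose two-generated subalgebras are perm algebras. Let $\mathcal{V}$ be the variety of $K$-algebras defined by the identities $$(a,b,c)+(a,c,b)=0,\qquad (a,b,c)+(b,a,c)=0,\qquad (ab)c+(cb)a=(ac)b+(ca)b,$$ where $(a,b,c)=(ab)c-a(bc)$. Then $$\mathcal{P}_2=\mathcal{V}.$$
   Context: Algebras are not assumed associative or unital. A perm algebra is an associative algebra satisfying the identity $abc-acb=0$. *)

theory Defs
  imports Complex_Main
begin

text \<open>
  The product is not assumed associative or unital, so the multiplicative type classes do not apply
  and it is a locale parameter. The underlying vector space is the whole type.
\<close>

locale nonassoc_algebra = vector_space scale
  for scale :: "'k::field \<Rightarrow> 'a::ab_group_add \<Rightarrow> 'a" (infixr \<open>*s\<close> 75) +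
  fixes mult :: "'a \<Rightarrow> 'a \<Rightarrow> 'a" (infixl \<open>\<cdot>\<close> 70)
  assumes mult_add_left: "(a + b) \<cdot> c = a \<cdot> c + b \<cdot> c"
    and mult_add_right: "a \<cdot> (b + c) = a \<cdot> b + a \<cdot> c"
    and mult_scale_left: "(r *s a) \<cdot> b = r *s (a \<cdot> b)"
    and mult_scale_right: "a \<cdot> (r *s b) = r *s (a \<cdot> b)"
begin

definition subalgebra :: "'a set \<Rightarrow> bool" where
  "subalgebra S \<longleftrightarrow> subspace S \<and> (\<forall>a\<in>S. \<forall>b\<in>S. a \<cdot> b \<in> S)"

definition two_generated :: "'a set \<Rightarrow> bool" where
  "two_generated S \<longleftrightarrow> (\<exists>x y. S = subalgebra hull {x, y})"

definition perm_subalgebra :: "'a set \<Rightarrow> bool" where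
  "perm_subalgebra S \<longleftrightarrow> subalgebra S \<and>
     (\<forall>a\<in>S. \<forall>b\<in>S. \<forall>c\<in>S. (a \<cdot> b) \<cdot> c = a \<cdot> (b \<cdot> c)) \<and>
     (\<forall>a\<in>S. \<forall>b\<in>S. \<forall>c\<in>S. (a \<cdot> b) \<cdot> c - (a \<cdot> c) \<cdot> b = 0)"

definition associator :: "'a \<Rightarrow> 'a \<Rightarrow> 'a \<Rightarrow> 'a" where
  "associator a b c = (a \<cdot> b) \<cdot> c - a \<cdot> (b \<cdot> c)"

end

locale binary_perm_algebra = nonassoc_algebra +
  assumes two_generated_perm: "two_generated S \<Longrightarrow> perm_subalgebra S"

locale V_algebra = nonassoc_algebra +
  assumes right_alternative: "associator a b c + associator a c b = 0"
    and left_alternative: "associator a b c + associator b a c = 0"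
    and V_identity: "(a \<cdot> b) \<cdot> c + (c \<cdot> b) \<cdot> a = (a \<cdot> c) \<cdot> b + (c \<cdot> a) \<cdot> b"

text \<open>
  A variety is represented, on each type with a fixed additive group, by the set of algebra
  structures (scalar multiplication, product) belonging to it. As the type and its group structure
  are arbitrary, equality of the polymorphic sets is equality of the varieties.
\<close>

type_synonym ('k, 'a) algebra_structure = "('k \<Rightarrow> 'a \<Rightarrow> 'a) \<times> ('a \<Rightarrow> 'a \<Rightarrow> 'a)"

definition binary_perm_variety :: "('k::field, 'a::ab_group_add) algebra_structure set" where
  "binary_perm_variety = {(scale, mult). binary_perm_algebra scale mult}"

definition V_variety :: "('k::field, 'a::ab_group_add) algebra_structure set" where
  "V_variety = {(scale, mult). V_algebra scale mult}"

end

theory Submission imports Defs begin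

text \<open>
  Both varieties are governed by identities in two variables. Polarising the defining identities of
  \<open>\<V>\<close> shows that, when 2 is invertible, they say that the algebra is alternative,
  \<open>(a,a,b) = (a,b,b) = 0\<close>, and satisfies \<open>(ab)a = (aa)b\<close>. Each of these three identities involves only
  two elements and holds in every perm algebra, so every binary perm algebra satisfies them.

  For the converse, consider the span \<open>M\<close> of the left-normed words in two elements \<open>x\<close> and \<open>y\<close>.
  The first point is Artin's theorem, that \<open>M\<close> is an associative subalgebra. It
  rests on the Moufang-type identity \<open>(wx,x,z) = x(w,x,z)\<close>: since only two letters are available,
  this identity alone gives \<open>(m,g,h) = 0\<close> for \<open>m \<in> M\<close> and letters \<open>g, h\<close>, and its linearisation
  \<open>(wx,y,z) = x(w,y,z) + y(w,x,z) - (wy,x,z)\<close> shortens a word in one slot at the cost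
  of lengthening another, which suffices to pass from letters to arbitrary elements of \<open>M\<close>
  (\<open>word_span_associative\<close>).

  The second point is that \<open>(ag)h = (ah)g\<close> for \<open>a \<in> M\<close> and letters \<open>g, h\<close>. By associativity
  only the last letter of \<open>a\<close> matters, and since there are only two letters, this last letter is \<open>g\<close>
  or \<open>h\<close> unless \<open>g = h\<close>; then \<open>(gg)h = (gh)g\<close> applies. Thus right multiplications by the letters
  commute on \<open>M\<close>, and with associativity all right multiplications by elements of \<open>M\<close> do.
\<close>

section \<open>Alternative algebras\<close>

context nonassoc_algebra
begin

lemma mult_zero_left [simp]: "0 \<cdot> a = 0"
  using mult_add_left[of 0 0 a] by simp

lemma mult_zero_right [simp]: "a \<cdot> 0 = 0"
  using mult_add_right[of a 0 0] by simp

lemma mult_minus_left: "(- a) \<cdot> b = - (a \<cdot> b)"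
  using mult_add_left[of a "- a" b] by (simp add: eq_neg_iff_add_eq_0 add.commute)

lemma mult_minus_right: "a \<cdot> (- b) = - (a \<cdot> b)"
  using mult_add_right[of a b "- b"] by (simp add: eq_neg_iff_add_eq_0 add.commute)

lemma mult_diff_left: "(a - b) \<cdot> c = a \<cdot> c - b \<cdot> c"
  using mult_add_left[of "a - b" b c] by (simp add: algebra_simps)

lemma mult_diff_right: "a \<cdot> (b - c) = a \<cdot> b - a \<cdot> c"
  using mult_add_right[of a "b - c" c] by (simp add: algebra_simps)

lemmas mult_linear = mult_add_left mult_add_right mult_diff_left mult_diff_right
  mult_minus_left mult_minus_right mult_scale_left mult_scale_right

lemma associator_add:
  "associator (a + a') b c = associator a b c + associator a' b c"
  "associator a (b + b') c = associator a b c + associator a b' c"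
  "associator a b (c + c') = associator a b c + associator a b c'"
  by (simp_all add: associator_def mult_linear)

lemma associator_scale:
  "associator (r *s a) b c = r *s associator a b c"
  "associator a (r *s b) c = r *s associator a b c"
  "associator a b (r *s c) = r *s associator a b c"
  by (simp_all add: associator_def mult_linear scale_right_diff_distrib)

lemma associator_zero [simp]:
  "associator 0 b c = 0" "associator a 0 c = 0" "associator a b 0 = 0"
  by (simp_all add: associator_def)

text \<open>The Teichmueller identity, which holds in every algebra: expanding the associators, each
  bracketing of \<open>abcd\<close> occurs with both signs.\<close>

lemma teichmueller:
  "associator (a \<cdot> b) c d - associator a (b \<cdot> c) d + associator a b (c \<cdot> d)
    = a \<cdot> associator b c d + associator a b c \<cdot> d"
  by (simp add: associator_def mult_linear)

lemma antisymmetric_if_diagonal_zero: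
  fixes f :: "'a \<Rightarrow> 'a \<Rightarrow> 'a"
  assumes "\<And>a b c. f (a + b) c = f a c + f b c"
    and "\<And>a b c. f a (b + c) = f a b + f a c"
    and "\<And>a. f a a = 0"
  shows "f a b + f b a = 0"
proof -
  have "f (a + b) (a + b) = (f a a + f a b) + (f b a + f b b)"
    by (simp only: assms(1,2) ac_simps)
  then show ?thesis by (simp add: assms(3))
qed

end

locale alternative_algebra = nonassoc_algebra +
  assumes associator_left_diag: "associator a a b = 0"
    and associator_right_diag: "associator a b b = 0"
begin

lemma associator_swap_left: "associator a b c = - associator b a c"
proof -
  have "associator a b c + associator b a c = 0"
    by (rule antisymmetric_if_diagonal_zero) (simp_all add: associator_add associator_left_diag)
  then show ?thesis by (simp add: eq_neg_iff_add_eq_0)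
qed

lemma associator_swap_right: "associator a b c = - associator a c b"
proof -
  have "associator a b c + associator a c b = 0"
    by (rule antisymmetric_if_diagonal_zero) (simp_all add: associator_add associator_right_diag)
  then show ?thesis by (simp add: eq_neg_iff_add_eq_0)
qed

lemma associator_cyclic: "associator a b c = associator b c a"
  using associator_swap_left[of a b c] associator_swap_right[of b a c] by simp

lemma associator_middle_diag: "associator a b a = 0"
  using associator_cyclic[of a b a] associator_right_diag[of b a] by simp

text \<open>Two instances of the Teichmueller identity with a repeated argument, in which \<open>(w,x\<^sup>2,z)\<close>
  cancels.\<close>

lemma moufang_associator: "associator (w \<cdot> x) x z = x \<cdot> associator w x z"
proof -
  have "associator (w \<cdot> x) x z = associator w (x \<cdot> x) z - associator w x (x \<cdot> z)"
    using teichmueller[of w x x z] associator_left_diag[of x z] associator_right_diag[of w x]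
    by (simp add: algebra_simps)
  also have "\<dots> = associator (x \<cdot> x) z w - associator x (x \<cdot> z) w"
    using associator_cyclic[of w "x \<cdot> x" z] associator_cyclic[of w x "x \<cdot> z"] by simp
  also have "\<dots> = x \<cdot> associator x z w"
    using teichmueller[of x x z w] associator_left_diag[of x] by simp
  also have "\<dots> = x \<cdot> associator w x z"
    using associator_cyclic[of w x z] by simp
  finally show ?thesis .
qed

lemma moufang_associator_linearised:
  "associator (w \<cdot> x) y z = x \<cdot> associator w y z + y \<cdot> associator w x z - associator (w \<cdot> y) x z"
  using moufang_associator[of w "x + y" z] moufang_associator[of w x z] moufang_associator[of w y z]
  by (simp add: associator_add mult_linear algebra_simps)

section \<open>Artin's theorem\<close>

text \<open>The span of the left-normed words in \<open>x\<close> and \<open>y\<close>. Building it by right multiplication with a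
  letter makes each proof below an induction on the last letter; that it is closed
  under multiplication is part of Artin's theorem.\<close>

inductive_set word_span for x y where
  zero: "0 \<in> word_span x y"
| letter: "g \<in> {x, y} \<Longrightarrow> g \<in> word_span x y"
| add: "m \<in> word_span x y \<Longrightarrow> n \<in> word_span x y \<Longrightarrow> m + n \<in> word_span x y"
| scale: "m \<in> word_span x y \<Longrightarrow> r *s m \<in> word_span x y"
| append: "m \<in> word_span x y \<Longrightarrow> g \<in> {x, y} \<Longrightarrow> m \<cdot> g \<in> word_span x y"

text \<open>If \<open>g \<noteq> h\<close>, the last letter of a word is \<open>g\<close> or \<open>h\<close> because there are only two letters, so
  \<open>(wx,x,z) = x(w,x,z)\<close> applies and removes it.\<close>

lemma associator_letters:
  assumes "m \<in> word_span x y" "g \<in> {x, y}" "h \<in> {x, y}"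
  shows "associator m g h = 0"
  using assms
proof (induction arbitrary: g h)
  case zero
  then show ?case by simp
next
  case (letter k)
  then show ?case
    by (auto simp: associator_left_diag associator_right_diag associator_middle_diag)
next
  case (add m n)
  then show ?case by (simp add: associator_add)
next
  case (scale m r)
  then show ?case by (simp add: associator_scale)
next
  case (append m k)
  show ?case
  proof (cases "g = h")
    case True
    then show ?thesis by (simp add: associator_right_diag)
  next
    case False
    with append.prems append.hyps consider "k = g" | "k = h" by auto
    then show ?thesis
    proof cases
      case 1
      then show ?thesis using append by (simp add: moufang_associator)
    next
      case 2
      have "associator (m \<cdot> h) h g = 0"
        using append by (simp add: moufang_associator)
      with 2 show ?thesis using associator_swap_right[of "m \<cdot> h" g h] by simp
    qed
  qed
qed

lemma letter_mult_word_span: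
  assumes "m \<in> word_span x y" "g \<in> {x, y}"
  shows "g \<cdot> m \<in> word_span x y"
  using assms
proof (induction)
  case (append m h)
  have "associator g m h = 0"
    using associator_cyclic[of g m h] associator_letters[of m x y h g] append by simp
  then have "g \<cdot> (m \<cdot> h) = (g \<cdot> m) \<cdot> h" by (simp add: associator_def)
  with append show ?case by (simp add: word_span.append)
qed (auto simp: mult_linear intro: word_span.intros)

text \<open>Both claims go through one induction: shortening \<open>n = n'k\<close> in \<open>(n,m,g)\<close> by the linearised
  Moufang-type identity produces \<open>(n'm,k,g)\<close>, which vanishes because \<open>n'm\<close> lies in the span again,
  and \<open>(n'k)m = n'(km)\<close> holds because \<open>(n',k,m)\<close> is an instance of the first claim.\<close>

lemma word_span_mult_and_associator_letter:
  assumes "n \<in> word_span x y"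
  shows "\<forall>m \<in> word_span x y. n \<cdot> m \<in> word_span x y \<and> (\<forall>g \<in> {x, y}. associator n m g = 0)"
  using assms
proof (induction)
  case zero
  then show ?case by (simp add: word_span.zero)
next
  case (letter h)
  show ?case
  proof (intro ballI conjI)
    fix m g assume m: "m \<in> word_span x y"
    then show "h \<cdot> m \<in> word_span x y" using letter letter_mult_word_span by blast
    assume "g \<in> {x, y}"
    then show "associator h m g = 0"
      using associator_cyclic[of h m g] associator_letters[OF m] letter by metis
  qed
next
  case (add m n)
  then show ?case by (simp add: mult_linear associator_add word_span.add)
next
  case (scale m r)
  then show ?case by (simp add: mult_linear associator_scale word_span.scale)
next
  case (append n k)
  show ?case
  proof (intro ballI conjI)
    fix m g assume m: "m \<in> word_span x y"
    have "associator n k m = 0"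
      using append m associator_swap_right[of n k m] by auto
    then have "(n \<cdot> k) \<cdot> m = n \<cdot> (k \<cdot> m)" by (simp add: associator_def)
    then show "(n \<cdot> k) \<cdot> m \<in> word_span x y"
      using append m letter_mult_word_span by simp
    assume g: "g \<in> {x, y}"
    have "n \<cdot> m \<in> word_span x y" using append m by blast
    then have "associator (n \<cdot> m) k g = 0"
      using associator_letters g append.hyps by blast
    moreover have "associator n m g = 0" using append m g by blast
    moreover have "associator n k g = 0" using associator_letters g append.hyps by blast
    ultimately show "associator (n \<cdot> k) m g = 0"
      using moufang_associator_linearised[of n k m g] by simp
  qed
qed

lemma word_span_mult:
  "n \<in> word_span x y \<Longrightarrow> m \<in> word_span x y \<Longrightarrow> n \<cdot> m \<in> word_span x y"
  using word_span_mult_and_associator_letter by blast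

lemma word_span_associator_letter:
  "n \<in> word_span x y \<Longrightarrow> m \<in> word_span x y \<Longrightarrow> g \<in> {x, y} \<Longrightarrow> associator n m g = 0"
  using word_span_mult_and_associator_letter by blast

lemma word_span_associator:
  assumes "p \<in> word_span x y" "n \<in> word_span x y" "m \<in> word_span x y"
  shows "associator p n m = 0"
  using assms
proof (induction arbitrary: n m)
  case zero
  then show ?case by simp
next
  case (letter g)
  then show ?case
    using associator_cyclic[of g n m] word_span_associator_letter by simp
next
  case (add p q)
  then show ?case by (simp add: associator_add)
next
  case (scale p r)
  then show ?case by (simp add: associator_scale)
next
  case (append p k)
  have "associator (p \<cdot> n) m k = 0"
    using append word_span_mult word_span_associator_letter by blast
  then have "associator (p \<cdot> n) k m = 0"
    using associator_swap_right[of "p \<cdot> n" k m] by simp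
  moreover have "associator p n m = 0" using append by blast
  moreover have "associator p k m = 0" using append word_span.letter by blast
  ultimately show ?case
    using moufang_associator_linearised[of p k n m] by simp
qed

lemma word_span_associative:
  assumes "a \<in> word_span x y" "b \<in> word_span x y" "c \<in> word_span x y"
  shows "(a \<cdot> b) \<cdot> c = a \<cdot> (b \<cdot> c)"
  using word_span_associator[OF assms] by (simp add: associator_def)

lemma subalgebra_word_span: "subalgebra (word_span x y)"
  unfolding subalgebra_def subspace_def
  by (auto intro: word_span.intros word_span_mult)

lemma hull_subset_word_span: "subalgebra hull {x, y} \<subseteq> word_span x y"
  by (rule hull_minimal) (auto intro: word_span.letter subalgebra_word_span)

end

section \<open>Alternative algebras with a two-variable perm identity\<close>

locale alternative_perm_algebra = alternative_algebra +
  assumes perm_diag: "(a \<cdot> b) \<cdot> a = (a \<cdot> a) \<cdot> b"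
begin

text \<open>Any three letters from \<open>{x, y}\<close> contain a repetition, so \<open>(ab)a = (aa)b\<close> settles words of length
  one; associativity reduces longer words to their last letter.\<close>

lemma right_mult_letters_commute:
  assumes "a \<in> word_span x y" "g \<in> {x, y}" "h \<in> {x, y}"
  shows "(a \<cdot> g) \<cdot> h = (a \<cdot> h) \<cdot> g"
  using assms
proof (induction arbitrary: g h)
  case zero
  then show ?case by simp
next
  case (letter k)
  then show ?case using perm_diag[of x y] perm_diag[of y x] by auto
next
  case (add m n)
  then show ?case by (simp add: mult_linear)
next
  case (scale m r)
  then show ?case by (simp add: mult_linear)
next
  case (append m k)
  have in_span: "k \<in> word_span x y" "g \<in> word_span x y" "h \<in> word_span x y"
    using append by (auto intro: word_span.letter)
  have "((m \<cdot> k) \<cdot> g) \<cdot> h = m \<cdot> ((k \<cdot> g) \<cdot> h)"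
    using append.hyps in_span by (simp add: word_span_associative word_span_mult)
  also have "(k \<cdot> g) \<cdot> h = (k \<cdot> h) \<cdot> g"
    using append.prems append.hyps perm_diag[of x y] perm_diag[of y x] by auto
  also have "m \<cdot> ((k \<cdot> h) \<cdot> g) = ((m \<cdot> k) \<cdot> h) \<cdot> g"
    using append.hyps in_span by (simp add: word_span_associative word_span_mult)
  finally show ?case .
qed

lemma right_mult_letter_commute:
  assumes "b \<in> word_span x y" "a \<in> word_span x y" "g \<in> {x, y}"
  shows "(a \<cdot> b) \<cdot> g = (a \<cdot> g) \<cdot> b"
  using assms
proof (induction arbitrary: a)
  case zero
  then show ?case by simp
next
  case (letter h)
  then show ?case using right_mult_letters_commute by blast
next
  case (add m n)
  then show ?case by (simp add: mult_linear)
next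
  case (scale m r)
  then show ?case by (simp add: mult_linear)
next
  case (append b h)
  have in_span: "g \<in> word_span x y" "h \<in> word_span x y"
    using append by (auto intro: word_span.letter)
  have "(a \<cdot> (b \<cdot> h)) \<cdot> g = ((a \<cdot> b) \<cdot> h) \<cdot> g"
    using append in_span by (simp add: word_span_associative)
  also have "\<dots> = ((a \<cdot> b) \<cdot> g) \<cdot> h"
    using append word_span_mult right_mult_letters_commute by blast
  also have "\<dots> = ((a \<cdot> g) \<cdot> b) \<cdot> h"
    using append by simp
  also have "\<dots> = (a \<cdot> g) \<cdot> (b \<cdot> h)"
    using append in_span word_span_mult word_span_associative by blast
  finally show ?case .
qed

lemma right_mult_commute:
  assumes "c \<in> word_span x y" "a \<in> word_span x y" "b \<in> word_span x y"
  shows "(a \<cdot> b) \<cdot> c = (a \<cdot> c) \<cdot> b"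
  using assms
proof (induction)
  case zero
  then show ?case by simp
next
  case (letter g)
  then show ?case using right_mult_letter_commute by blast
next
  case (add m n)
  then show ?case by (simp add: mult_linear)
next
  case (scale m r)
  then show ?case by (simp add: mult_linear)
next
  case (append c h)
  have h: "h \<in> word_span x y" using append by (auto intro: word_span.letter)
  have "(a \<cdot> b) \<cdot> (c \<cdot> h) = ((a \<cdot> b) \<cdot> c) \<cdot> h"
    using word_span_associative[OF word_span_mult[OF append.prems] append.hyps(1) h] by simp
  also have "\<dots> = ((a \<cdot> c) \<cdot> b) \<cdot> h"
    by (simp only: append.IH[OF append.prems])
  also have "\<dots> = ((a \<cdot> c) \<cdot> h) \<cdot> b"
    using append word_span_mult right_mult_letter_commute by blast
  also have "\<dots> = (a \<cdot> (c \<cdot> h)) \<cdot> b"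
    using word_span_associative[OF append.prems(1) append.hyps(1) h] by simp
  finally show ?case .
qed

end

section \<open>Comparison of the two varieties\<close>

context nonassoc_algebra
begin

lemma subalgebra_hull: "subalgebra (subalgebra hull A)"
  by (rule hull_in) (auto simp: subalgebra_def intro: subspace_Inter)

end

sublocale alternative_perm_algebra \<subseteq> binary_perm_algebra
proof
  fix S assume "two_generated S"
  then obtain x y where S: "S = subalgebra hull {x, y}"
    unfolding two_generated_def by blast
  then have sub: "S \<subseteq> word_span x y" using hull_subset_word_span by simp
  have "(a \<cdot> b) \<cdot> c = a \<cdot> (b \<cdot> c)" if "a \<in> S" "b \<in> S" "c \<in> S" for a b c
    using that sub word_span_associative by blast
  moreover have "(a \<cdot> b) \<cdot> c = (a \<cdot> c) \<cdot> b" if "a \<in> S" "b \<in> S" "c \<in> S" for a b c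
    using that sub right_mult_commute by blast
  ultimately show "perm_subalgebra S"
    unfolding perm_subalgebra_def using S subalgebra_hull by simp
qed

sublocale binary_perm_algebra \<subseteq> alternative_perm_algebra
proof
  fix a b
  let ?S = "subalgebra hull {a, b}"
  have ab: "a \<in> ?S" "b \<in> ?S" by (auto intro: hull_inc)
  have perm: "perm_subalgebra ?S"
    using two_generated_perm two_generated_def by blast
  show "associator a a b = 0" "associator a b b = 0"
    using perm ab unfolding perm_subalgebra_def associator_def by simp_all
  have "(a \<cdot> b) \<cdot> a - (a \<cdot> a) \<cdot> b = 0"
    using perm ab unfolding perm_subalgebra_def by blast
  then show "(a \<cdot> b) \<cdot> a = (a \<cdot> a) \<cdot> b" by simp
qed

text \<open>The third identity of \<open>\<V>\<close> is the polarisation of \<open>(ab)a = (aa)b\<close> in \<open>a\<close>.\<close>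

lemma (in alternative_perm_algebra) V_algebra: "V_algebra scale mult"
proof
  fix a b c
  show "associator a b c + associator a c b = 0"
    using associator_swap_right[of a b c] by simp
  show "associator a b c + associator b a c = 0"
    using associator_swap_left[of a b c] by simp
  let ?f = "\<lambda>a c. (a \<cdot> b) \<cdot> c - (a \<cdot> c) \<cdot> b"
  have "?f a c + ?f c a = 0"
    by (rule antisymmetric_if_diagonal_zero) (simp_all add: mult_linear perm_diag)
  then show "(a \<cdot> b) \<cdot> c + (c \<cdot> b) \<cdot> a = (a \<cdot> c) \<cdot> b + (c \<cdot> a) \<cdot> b"
    by (simp add: algebra_simps)
qed

text \<open>The characteristic enters only here, to divide \<open>2 (a,a,b) = 0\<close> and \<open>2 (a,b,b) = 0\<close> by 2. The
  identity \<open>(ab)a = (aa)b\<close> needs no division: putting \<open>b = a\<close> in the third identity of \<open>\<V>\<close> makes the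
  two terms \<open>(ca)a\<close> cancel.\<close>

lemma alternative_perm_algebra_if_V_algebra:
  fixes scale :: "'k::field_char_0 \<Rightarrow> 'a::ab_group_add \<Rightarrow> 'a" and mult :: "'a \<Rightarrow> 'a \<Rightarrow> 'a"
  assumes "V_algebra scale mult"
  shows "alternative_perm_algebra scale mult"
proof -
  interpret V_algebra scale mult by fact
  have half: "u = 0" if "u + u = 0" for u :: 'a
  proof -
    have "scale 2 u = u + u"
      using scale_left_distrib[of 1 1 u] by simp
    with that show ?thesis by simp
  qed
  show ?thesis
  proof
    fix a b
    show "associator a a b = 0" using half left_alternative[of a a b] .
    show "associator a b b = 0" using half right_alternative[of a b b] .
    show "mult (mult a b) a = mult (mult a a) b"
      using V_identity[of a a b] by simp
  qed
qed

theorem corollary5: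
  "(binary_perm_variety :: ('k::field_char_0, 'a::ab_group_add) algebra_structure set) = V_variety"
proof -
  have "binary_perm_algebra scale mult \<longleftrightarrow> V_algebra scale mult"
    for scale :: "'k \<Rightarrow> 'a \<Rightarrow> 'a" and mult
  proof
    assume "binary_perm_algebra scale mult"
    then interpret binary_perm_algebra scale mult .
    show "V_algebra scale mult" by (rule V_algebra)
  next
    assume "V_algebra scale mult"
    then interpret alternative_perm_algebra scale mult
      by (rule alternative_perm_algebra_if_V_algebra)
    show "binary_perm_algebra scale mult" by unfold_locales
  qed
  then show ?thesis by (simp add: binary_perm_variety_def V_variety_def)
qed

end
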